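(* Let $\imath=\sqrt{-1}$, let $a$ be a parameter, let $g_1,\dots,g_{n+1}$ be coupling constants with $g_2\neq 0$, and put $\kappa=\frac{g_1}{\sqrt{2g_2}}$. Consider the quadratic $BC_n$-Toda Hamiltonian in $x=(x_1,\dots,x_n)$ $$H^{BC_n}(x)=-\frac12\sum_{i=1}^n\frac{\partial^2}{\partial x_i^2}+g_1e^{x_1}+g_2e^{2x_1}+\sum_{k=1}^{n-1}g_{k+2}e^{x_{k+1}-x_k},$$ and the quadratic Hamiltonian of the $I_n$-Toda (Inozemtsev) chain in $z=(z_1,\dots,z_n)$ $$H^{I_n}(z)=-\frac12\sum_{i=1}^n\frac{\partial^2}{\partial z_i^2}+\frac{\tilde g_1}{(e^{-z_1/2}-e^{z_1/2})^2}+\frac{\tilde g_2}{(e^{-z_1}-e^{z_1})^2}+g_3\sqrt{\tfrac{g_2}{2}}\,\bigl(e^{z_1+z_2}+e^{z_2-z_1}\bigr)+\sum_{k=2}^{n-1}g_{k+2}e^{z_{k+1}-z_k},$$ where $$\tilde g_1=-(2\imath a+1)\kappa,\qquad \tilde g_2=2(\imath a+\kappa)+2(\imath a+\kappa)^2.$$ Let $$Q^{*}(z;x)=\left(\frac{1-e^{z_1}}{1+e^{z_1}}\right)^{\kappa}\exp\Bigl\{-\sqrt{\tfrac{g_2}{2}}\bigl(e^{x_1+z_1}+e^{x_1-z_1}\bigr)-\sum_{i=2}^n\bigl(g_{i+1}e^{z_i-x_{i-1}}+e^{x_i-z_i}\bigr)\Bigr\}$$ and $$Q(z;x|a)=(1-e^{2z_1})^{-2\imath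 a}\,\exp\Bigl\{\imath a\sum_{i=1}^n(z_i-x_i)\Bigr\}\,Q^{*}(z;x).$$ Then the integral operator with kernel $Q(z;x|a)$ intertwines the quadratic Hamiltonians of the $I_n$- and $BC_n$-type Toda chains: $$H^{I_n}(z)\,Q(z;x|a)=Q(z;x|a)\,H^{BC_n}(x).$$
   Context: Convention for intertwining relations: in an identity $H(z)\,Q(z;x)=Q(z;x)\,H'(x)$ the Hamiltonian operator on the left-hand side acts to the right, on $Q$ as a function of $z$, and the Hamiltonian on the right-hand side acts to the left, on $Q$ as a function of $x$. Since the operators here have the form $-\frac12\Delta+$potential, the relation is the identity of functions $H(z)[Q(z;x)]=H'(x)[Q(z;x)]$. Empty sums are zero, and for $n=1$ terms containing the nonexistent variable $z_2$ are omitted.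
   Formalization: The exponent of (1-e^{2z_1}) in Q(z;x|a) is taken to be -ia instead of the printed -2ia, for which the identity fails whenever a is nonzero (a term -2ia sqrt(g_2/2) e^{x_1+z_1} is left over); x, z are real with z_1 nonzero, and roots and powers are principal. *)

theory Defs
  imports "HOL-Analysis.Analysis"
begin

(* Points x = (x_1,...,x_n) are functions nat => real of which only the values at 1..n are used;
   likewise the couplings g_1,...,g_{n+1} are g 1, ..., g (n + 1).  Couplings and the parameter a
   are complex, because g_2 may be negative (or non-real) and then kappa and sqrt (g_2 / 2) are not
   real.  csqrt is the principal root, so csqrt (2 * g_2) = 2 * csqrt (g_2 / 2): the square roots
   in kappa, in the Hamiltonian and in the kernel are chosen consistently. *)

definition pderiv_at :: "nat \<Rightarrow> ((nat \<Rightarrow> real) \<Rightarrow> complex) \<Rightarrow> (nat \<Rightarrow> real) \<Rightarrow> complex" where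
  "pderiv_at i F x = vector_derivative (\<lambda>t. F (x(i := t))) (at (x i))"

definition laplacian :: "nat \<Rightarrow> ((nat \<Rightarrow> real) \<Rightarrow> complex) \<Rightarrow> (nat \<Rightarrow> real) \<Rightarrow> complex" where
  "laplacian n F x = (\<Sum>i=1..n. pderiv_at i (pderiv_at i F) x)"

definition kappa :: "(nat \<Rightarrow> complex) \<Rightarrow> complex" where
  "kappa g = g 1 / csqrt (2 * g 2)"

definition H_BC ::
  "nat \<Rightarrow> (nat \<Rightarrow> complex) \<Rightarrow> ((nat \<Rightarrow> real) \<Rightarrow> complex) \<Rightarrow> (nat \<Rightarrow> real) \<Rightarrow> complex" where
  "H_BC n g F x =
     - (1/2) * laplacian n F x
     + (g 1 * exp (of_real (x 1)) + g 2 * exp (of_real (2 * x 1))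
        + (\<Sum>k\<in>{1..<n}. g (k + 2) * exp (of_real (x (k + 1) - x k)))) * F x"

definition g1_tilde :: "(nat \<Rightarrow> complex) \<Rightarrow> complex \<Rightarrow> complex" where
  "g1_tilde g a = - (2 * \<i> * a + 1) * kappa g"

definition g2_tilde :: "(nat \<Rightarrow> complex) \<Rightarrow> complex \<Rightarrow> complex" where
  "g2_tilde g a = 2 * (\<i> * a + kappa g) + 2 * (\<i> * a + kappa g)^2"

(* For n = 1 there is no variable z_2, and the term containing it is absent. *)
definition H_I ::
  "nat \<Rightarrow> (nat \<Rightarrow> complex) \<Rightarrow> complex \<Rightarrow> ((nat \<Rightarrow> real) \<Rightarrow> complex) \<Rightarrow> (nat \<Rightarrow> real) \<Rightarrow> complex" where
  "H_I n g a F z =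
     - (1/2) * laplacian n F z
     + (g1_tilde g a / of_real ((exp (- z 1 / 2) - exp (z 1 / 2))^2)
        + g2_tilde g a / of_real ((exp (- z 1) - exp (z 1))^2)
        + (if n \<ge> 2
           then g 3 * csqrt (g 2 / 2) * of_real (exp (z 1 + z 2) + exp (z 2 - z 1))
           else 0)
        + (\<Sum>k\<in>{2..<n}. g (k + 2) * exp (of_real (z (k + 1) - z k)))) * F z"

(* The powers below have real bases, positive for z_1 < 0 and negative for z_1 > 0; complex powr
   is the principal branch, which is smooth in z_1 along each of these two half-lines. *)

definition Q_star ::
  "nat \<Rightarrow> (nat \<Rightarrow> complex) \<Rightarrow> (nat \<Rightarrow> real) \<Rightarrow> (nat \<Rightarrow> real) \<Rightarrow> complex" where
  "Q_star n g z x =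
     of_real ((1 - exp (z 1)) / (1 + exp (z 1))) powr kappa g
     * exp (- csqrt (g 2 / 2) * of_real (exp (x 1 + z 1) + exp (x 1 - z 1))
            - (\<Sum>i=2..n. g (i + 1) * exp (of_real (z i - x (i - 1)))
                        + exp (of_real (x i - z i))))"

(* The exponent of 1 - exp (2 * z_1) is -i a.  It is sometimes printed as -2 i a, but with that
   exponent (H_I Q - Q H_BC) / Q contains the term
   -2 i a csqrt (g_2 / 2) exp (x_1 + z_1), which nothing else cancels; the potential in H_I
   (g1_tilde, g2_tilde) matches precisely the exponent -i a. *)
definition Q_kernel ::
  "nat \<Rightarrow> (nat \<Rightarrow> complex) \<Rightarrow> complex \<Rightarrow> (nat \<Rightarrow> real) \<Rightarrow> (nat \<Rightarrow> real) \<Rightarrow> complex" where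
  "Q_kernel n g a z x =
     of_real (1 - exp (2 * z 1)) powr (- \<i> * a)
     * exp (\<i> * a * of_real (\<Sum>i=1..n. z i - x i))
     * Q_star n g z x"

end

theory Submission
  imports Defs
begin

text \<open>
  In every coordinate \<open>t\<close> except \<open>z\<^sub>1\<close> the kernel has the form
  \<open>K exp (s t + \<alpha> e\<^sup>t + \<beta> e\<^sup>-\<^sup>t)\<close>, so its second derivative is
  \<open>((s + \<alpha> e\<^sup>t - \<beta> e\<^sup>-\<^sup>t)\<^sup>2 + \<alpha> e\<^sup>t + \<beta> e\<^sup>-\<^sup>t) Q\<close>. Put
  \<open>u\<^sub>j = g\<^sub>j\<^sub>+\<^sub>1 exp (z\<^sub>j - x\<^sub>j\<^sub>-\<^sub>1)\<close> and \<open>w\<^sub>j = exp (x\<^sub>j - z\<^sub>j)\<close>. Both Laplacians are sums of squares in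
  \<open>u\<close> and \<open>w\<close> that agree up to the mixed products: \<open>w\<^sub>j u\<^sub>j\<^sub>+\<^sub>1\<close> is the Toda interaction
  of \<open>z\<^sub>j, z\<^sub>j\<^sub>+\<^sub>1\<close> and \<open>u\<^sub>j w\<^sub>j\<close> that of \<open>x\<^sub>j\<^sub>-\<^sub>1, x\<^sub>j\<close>. What remains is a one-variable identity
  at the boundary, rational in \<open>exp z\<^sub>1\<close>, which matches the Inozemtsev potential with
  \<open>g\<^sub>1 e\<^sup>x + g\<^sub>2 e\<^sup>2\<^sup>x\<close> at \<open>x = x\<^sub>1\<close>.
\<close>

section \<open>Logarithmic derivatives, complex powers and the square roots\<close>

text \<open>Product rule applied to \<open>F' = p * F\<close>. The outer derivative sees the inner
  one near \<open>x i\<close>, so the first-order formula is needed on an open set; a proper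
  \<open>U\<close> allows \<open>z 1 = 0\<close> to be left out.\<close>

lemma pderiv_at_twice:
  assumes U: "open U" "x i \<in> U"
    and F: "\<And>t. t \<in> U \<Longrightarrow>
      ((\<lambda>s. F (x(i := s))) has_vector_derivative p t * F (x(i := t))) (at t)"
    and p: "(p has_vector_derivative q) (at (x i))"
  shows "pderiv_at i (pderiv_at i F) x = ((p (x i))\<^sup>2 + q) * F x"
proof -
  have 1: "pderiv_at i F (x(i := t)) = p t * F (x(i := t))" if "t \<in> U" for t
    using vector_derivative_at[OF F[OF that]] by (simp add: pderiv_at_def)
  have "((\<lambda>t. p t * F (x(i := t))) has_vector_derivative
          p (x i) * (p (x i) * F (x(i := x i))) + q * F (x(i := x i))) (at (x i))"
    by (rule has_vector_derivative_mult[OF p F[OF U(2)]])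
  from has_vector_derivative_transform_within_open[OF this U 1[symmetric]]
  have "((\<lambda>t. pderiv_at i F (x(i := t))) has_vector_derivative
          ((p (x i))\<^sup>2 + q) * F x) (at (x i))"
    by (simp add: power2_eq_square algebra_simps)
  then show ?thesis
    unfolding pderiv_at_def[of i "pderiv_at i F" x] by (rule vector_derivative_at)
qed

lemma pderiv_at_twice_exp:
  fixes s \<alpha> \<beta> K :: complex
  assumes "\<And>t. F (x(i := t)) = K * exp (s * of_real t + \<alpha> * exp (of_real t) + \<beta> * exp (- of_real t))"
  shows "pderiv_at i (pderiv_at i F) x =
    ((s + \<alpha> * exp (of_real (x i)) - \<beta> * exp (- of_real (x i)))\<^sup>2
      + \<alpha> * exp (of_real (x i)) + \<beta> * exp (- of_real (x i))) * F x"
proof -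
  have "((\<lambda>s. F (x(i := s))) has_vector_derivative
      (s + \<alpha> * exp (of_real t) - \<beta> * exp (- of_real t)) * F (x(i := t))) (at t)" for t
    unfolding assms
    by (rule has_vector_derivative_real_field)
       (auto intro!: derivative_eq_intros simp: algebra_simps)
  moreover have "((\<lambda>t. s + \<alpha> * exp (of_real t) - \<beta> * exp (- of_real t)) has_vector_derivative
      \<alpha> * exp (of_real (x i)) + \<beta> * exp (- of_real (x i))) (at (x i))"
    by (rule has_vector_derivative_real_field) (auto intro!: derivative_eq_intros)
  ultimately show ?thesis
    by (subst pderiv_at_twice[where U = UNIV]) (auto simp: algebra_simps)
qed

text \<open>For a negative base, \<open>Ln\<close> sits on its branch cut, but along the real axis it is
  \<open>ln (- r) + \<i> \<pi>\<close>, which is still smooth.\<close>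

lemma has_vector_derivative_of_real_powr:
  fixes r :: "real \<Rightarrow> real" and w :: complex
  assumes r: "(r has_real_derivative r') (at t)" and nz: "r t \<noteq> 0"
  shows "((\<lambda>s. of_real (r s) powr w) has_vector_derivative
           w * of_real (r' / r t) * of_real (r t) powr w) (at t)"
proof -
  define \<sigma> where "\<sigma> = sgn (r t)"
  have \<sigma>: "\<sigma> * r t > 0" using nz by (auto simp: \<sigma>_def sgn_if)
  \<comment> \<open>The sign is frozen at its value at \<open>t\<close>. Near \<open>t\<close>,
    \<open>\<sigma> * r s\<close> is the absolute value of \<open>r s\<close>, and \<open>G\<close>
    is the power with the logarithm of a possibly negative real written out.\<close>
  define G where "G s = exp (w * (of_real (ln (\<sigma> * r s)) + (if \<sigma> < 0 then pi * \<i> else 0)))" for s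
  have "isCont r t" using r by (rule DERIV_isCont)
  then have "((\<lambda>s. \<sigma> * r s) \<longlongrightarrow> \<sigma> * r t) (at t)" by (intro tendsto_intros) (simp add: isCont_def)
  then have ev: "eventually (\<lambda>s. \<sigma> * r s > 0) (at t)" using \<sigma> by (rule order_tendstoD)
  have eq: "of_real (r s) powr w = G s" if "\<sigma> * r s > 0" for s
  proof -
    have "r s \<noteq> 0" "\<sigma> * r s = \<bar>r s\<bar>" "\<sigma> < 0 \<longleftrightarrow> r s < 0"
      using that by (auto simp: \<sigma>_def sgn_if split: if_splits)
    then show ?thesis by (simp add: powr_def G_def Ln_of_real')
  qed
  have "((\<lambda>s. ln (\<sigma> * r s)) has_real_derivative r' / r t) (at t)"
    using \<sigma> nz by (auto intro!: derivative_eq_intros r)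
  then have "((\<lambda>s. of_real (ln (\<sigma> * r s)) :: complex) has_vector_derivative of_real (r' / r t)) (at t)"
    by (intro has_vector_derivative_of_real) (simp add: has_real_derivative_iff_has_vector_derivative)
  then have "((\<lambda>s. w * (of_real (ln (\<sigma> * r s)) + (if \<sigma> < 0 then pi * \<i> else 0)))
      has_vector_derivative w * (of_real (r' / r t) + 0)) (at t)"
    by (intro has_vector_derivative_mult_right has_vector_derivative_add has_vector_derivative_const)
  from field_vector_diff_chain_at[OF this DERIV_exp]
  have "(G has_vector_derivative w * of_real (r' / r t) * G t) (at t)"
    by (simp add: o_def G_def[abs_def] mult_ac)
  then show ?thesis
    using ev \<sigma> eq
    by (subst has_vector_derivative_cong_ev[where g = G])
       (auto simp: eventually_at_filter eq elim: eventually_mono)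
qed

text \<open>Doubling preserves the half-plane of principal roots, so \<open>csqrt (2 * g 2)\<close>
  is twice \<open>csqrt (g 2 / 2)\<close>. This is what turns a cross term at the boundary into the
  \<open>g 1\<close> potential.\<close>

lemma csqrt_kappa:
  assumes "g 2 \<noteq> 0"
  shows "2 * kappa g * csqrt (g 2 / 2) = g 1"
proof -
  have "csqrt (2 * g 2) = 2 * csqrt (g 2 / 2)"
  proof (rule csqrt_unique)
    show "(2 * csqrt (g 2 / 2))\<^sup>2 = 2 * g 2" by (simp add: power_mult_distrib)
    show "0 < Re (2 * csqrt (g 2 / 2)) \<or> Re (2 * csqrt (g 2 / 2)) = 0 \<and> 0 \<le> Im (2 * csqrt (g 2 / 2))"
      using csqrt_principal[of "g 2 / 2"] by simp
  qed
  with assms show ?thesis by (simp add: kappa_def)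
qed

section \<open>The kernel as a prefactor times an exponential\<close>

lemma sum_fun_upd:
  fixes f :: "'i \<Rightarrow> 'b \<Rightarrow> 'c::ab_group_add"
  assumes "finite I"
  shows "(\<Sum>i\<in>I. f i ((z(j := t)) i)) = (\<Sum>i\<in>I. f i (z i)) + (if j \<in> I then f j t - f j (z j) else 0)"
proof -
  have "f i ((z(j := t)) i) = f i (z i) + (if i = j then f j t - f j (z j) else 0)" for i
    by simp
  with assms show ?thesis by (simp only: sum.distrib sum.delta)
qed

text \<open>\<open>c\<close> stands for \<open>\<i> * a\<close>. These are the powers whose bases
  vanish at \<open>z 1 = 0\<close>; no other coordinate enters them.\<close>

definition prefactor :: "(nat \<Rightarrow> complex) \<Rightarrow> complex \<Rightarrow> real \<Rightarrow> complex" where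
  "prefactor g c t = of_real (1 - exp (2 * t)) powr (- c)
     * of_real ((1 - exp t) / (1 + exp t)) powr kappa g"

text \<open>Exponentials of differences are split into products, so that each coordinate
  \<open>t\<close> enters only through \<open>t\<close>, \<open>exp t\<close> and
  \<open>exp (- t)\<close>, as \<open>pderiv_at_twice_exp\<close> requires.\<close>

definition exponent ::
  "nat \<Rightarrow> (nat \<Rightarrow> complex) \<Rightarrow> complex \<Rightarrow> (nat \<Rightarrow> real) \<Rightarrow> (nat \<Rightarrow> real) \<Rightarrow> complex" where
  "exponent n g c z x =
     c * (\<Sum>i=1..n. of_real (z i)) - c * (\<Sum>i=1..n. of_real (x i))
     - csqrt (g 2 / 2) * exp (of_real (x 1)) * (exp (of_real (z 1)) + exp (- of_real (z 1)))
     - (\<Sum>i=2..n. g (i + 1) * exp (of_real (z i)) * exp (- of_real (x (i - 1))))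
     - (\<Sum>i=2..n. exp (of_real (x i)) * exp (- of_real (z i)))"

lemma Q_kernel_eq: "Q_kernel n g a z x = prefactor g (\<i> * a) (z 1) * exp (exponent n g (\<i> * a) z x)"
proof -
  have "exponent n g (\<i> * a) z x = \<i> * a * of_real (\<Sum>i=1..n. z i - x i) +
     (- csqrt (g 2 / 2) * of_real (exp (x 1 + z 1) + exp (x 1 - z 1))
            - (\<Sum>i=2..n. g (i + 1) * exp (of_real (z i - x (i - 1)))
                        + exp (of_real (x i - z i))))"
    unfolding exponent_def of_real_add of_real_mult of_real_sum of_real_diff exp_of_real[symmetric]
      diff_conv_add_uminus[of "complex_of_real _"] exp_add sum.distrib sum_negf
    by (simp add: algebra_simps)
  then show ?thesis
    unfolding Q_kernel_def Q_star_def prefactor_def by (simp add: exp_add mult_ac)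
qed

text \<open>The increment form separates the dependence on \<open>t\<close> from a constant, which
  then goes into the factor \<open>K\<close> of \<open>pderiv_at_twice_exp\<close>.\<close>

lemma exponent_upd_z:
  assumes "j \<in> {1..n}"
  shows "exponent n g c (z(j := t)) x = exponent n g c z x + c * (of_real t - of_real (z j))
    - (if j = 1 then csqrt (g 2 / 2) * exp (of_real (x 1)) *
         (exp (of_real t) + exp (- of_real t) - exp (of_real (z 1)) - exp (- of_real (z 1)))
       else g (j + 1) * exp (- of_real (x (j - 1))) * (exp (of_real t) - exp (of_real (z j)))
         + exp (of_real (x j)) * (exp (- of_real t) - exp (- of_real (z j))))"
proof -
  note 1 = sum_fun_upd[of "{1..n}" "\<lambda>i v. complex_of_real v" z j t]
  note 2 = sum_fun_upd[of "{2..n}" "\<lambda>i v. g (i + 1) * exp (of_real v) * exp (- of_real (x (i - 1)))" z j t]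
  note 3 = sum_fun_upd[of "{2..n}" "\<lambda>i v. exp (of_real (x i)) * exp (- of_real v)" z j t]
  show ?thesis
    using assms unfolding exponent_def 1[OF finite_atLeastAtMost] 2[OF finite_atLeastAtMost]
      3[OF finite_atLeastAtMost]
    by (simp add: algebra_simps)
qed

text \<open>\<open>x j\<close> sits at index \<open>j + 1\<close> of the sum with couplings. After
  the shift it sits at index \<open>j\<close>, as \<open>sum_fun_upd\<close> needs; the range stops
  below \<open>n\<close> because \<open>x n\<close> has no partner \<open>z (n + 1)\<close>.\<close>

lemma exponent_alt:
  "exponent n g c z x =
     c * (\<Sum>i=1..n. of_real (z i)) - c * (\<Sum>i=1..n. of_real (x i))
     - csqrt (g 2 / 2) * exp (of_real (x 1)) * (exp (of_real (z 1)) + exp (- of_real (z 1)))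
     - (\<Sum>i=1..<n. g (i + 2) * exp (of_real (z (i + 1))) * exp (- of_real (x i)))
     - (\<Sum>i=2..n. exp (of_real (x i)) * exp (- of_real (z i)))"
proof -
  have "(\<Sum>i=2..n. g (i + 1) * exp (of_real (z i)) * exp (- of_real (x (i - 1)))) =
    (\<Sum>i=1..<n. g (i + 2) * exp (of_real (z (i + 1))) * exp (- of_real (x i)))"
    by (rule sum.reindex_bij_witness[of _ Suc "\<lambda>i. i - 1"]) (auto simp: numeral_eq_Suc)
  then show ?thesis by (simp add: exponent_def)
qed

lemma exponent_upd_x:
  assumes "j \<in> {1..n}"
  shows "exponent n g c z (x(j := t)) = exponent n g c z x - c * (of_real t - of_real (x j))
    - (if j = 1 then csqrt (g 2 / 2) * (exp (of_real (z 1)) + exp (- of_real (z 1)))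
       else exp (- of_real (z j))) * (exp (of_real t) - exp (of_real (x j)))
    - (if j < n then g (j + 2) * exp (of_real (z (j + 1))) else 0) * (exp (- of_real t) - exp (- of_real (x j)))"
proof -
  note 1 = sum_fun_upd[of "{1..n}" "\<lambda>i v. complex_of_real v" x j t]
  note 2 = sum_fun_upd[of "{1..<n}" "\<lambda>i v. g (i + 2) * exp (of_real (z (i + 1))) * exp (- of_real v)" x j t]
  note 3 = sum_fun_upd[of "{2..n}" "\<lambda>i v. exp (of_real v) * exp (- of_real (z i))" x j t]
  show ?thesis
    using assms unfolding exponent_alt 1[OF finite_atLeastAtMost] 2[OF finite_atLeastLessThan]
      3[OF finite_atLeastAtMost]
    by (cases "j = 1") (simp_all add: algebra_simps)
qed

section \<open>Second derivatives of the kernel in each coordinate\<close>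

lemma pderiv2_z:
  fixes x z :: "nat \<Rightarrow> real" and g :: "nat \<Rightarrow> complex" and a :: complex
  assumes "j \<in> {2..n}"
  defines "u \<equiv> g (j + 1) * exp (of_real (z j - x (j - 1)))" and "w \<equiv> exp (of_real (x j - z j))"
  shows "pderiv_at j (pderiv_at j (\<lambda>z. Q_kernel n g a z x)) z =
    ((\<i> * a - u + w)\<^sup>2 - u - w) * Q_kernel n g a z x"
proof -
  define \<alpha> where "\<alpha> = - (g (j + 1) * exp (- complex_of_real (x (j - 1))))"
  define \<beta> where "\<beta> = - exp (complex_of_real (x j))"
  \<comment> \<open>As \<open>j\<close> is at least 2, the update leaves the prefactor
    unchanged.\<close>
  have *: "Q_kernel n g a (z(j := t)) x =
    prefactor g (\<i> * a) (z 1) * exp (exponent n g (\<i> * a) z x - \<i> * a * of_real (z j)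
        - \<alpha> * exp (of_real (z j)) - \<beta> * exp (- of_real (z j)))
      * exp (\<i> * a * of_real t + \<alpha> * exp (of_real t) + \<beta> * exp (- of_real t))" for t
    using assms(1) unfolding Q_kernel_eq mult.assoc exp_add[symmetric]
    by (simp add: exponent_upd_z \<alpha>_def \<beta>_def algebra_simps)
  have "\<alpha> * exp (of_real (z j)) = - u" "\<beta> * exp (- of_real (z j)) = - w"
    by (simp_all add: \<alpha>_def \<beta>_def u_def w_def exp_diff exp_minus field_simps)
  then show ?thesis
    by (subst pderiv_at_twice_exp[OF *]) simp
qed

lemma pderiv2_x:
  fixes x z :: "nat \<Rightarrow> real" and g :: "nat \<Rightarrow> complex"
  assumes "j \<in> {1..n}"
  defines "v \<equiv> if j < n then g (j + 2) * exp (of_real (z (j + 1) - x j)) else 0"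
    and "w \<equiv> if j = 1 then csqrt (g 2 / 2) * of_real (exp (x 1 + z 1) + exp (x 1 - z 1))
      else exp (of_real (x j - z j))"
  shows "pderiv_at j (pderiv_at j (\<lambda>x. Q_kernel n g a z x)) x =
    ((\<i> * a + w - v)\<^sup>2 - w - v) * Q_kernel n g a z x"
proof -
  define \<alpha> where "\<alpha> = - (if j = 1 then csqrt (g 2 / 2) * (exp (of_real (z 1)) + exp (- of_real (z 1)))
       else exp (- complex_of_real (z j)))"
  define \<beta> where "\<beta> = - (if j < n then g (j + 2) * exp (complex_of_real (z (j + 1))) else 0)"
  have *: "Q_kernel n g a z (x(j := t)) =
    prefactor g (\<i> * a) (z 1) * exp (exponent n g (\<i> * a) z x + \<i> * a * of_real (x j)
        - \<alpha> * exp (of_real (x j)) - \<beta> * exp (- of_real (x j)))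
      * exp (- \<i> * a * of_real t + \<alpha> * exp (of_real t) + \<beta> * exp (- of_real t))" for t
    using assms(1) unfolding Q_kernel_eq mult.assoc exp_add[symmetric]
    by (simp only: exponent_upd_x[OF assms(1)] \<alpha>_def[symmetric] \<beta>_def[symmetric])
       (simp add: \<alpha>_def \<beta>_def algebra_simps)
  have "\<alpha> * exp (of_real (x j)) = - w" "\<beta> * exp (- of_real (x j)) = - v"
    by (simp_all add: \<alpha>_def \<beta>_def v_def w_def exp_add exp_diff exp_minus field_simps flip: exp_of_real)
  \<comment> \<open>The linear term in \<open>x\<close> has the opposite sign to that in
    \<open>z\<close>; squaring removes this sign and gives both derivatives the same shape.\<close>
  moreover have "(- \<i> * a + - w - - v)\<^sup>2 = (\<i> * a + w - v)\<^sup>2"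
    by (simp add: power2_eq_square algebra_simps)
  ultimately show ?thesis
    by (subst pderiv_at_twice_exp[OF *]) simp
qed

text \<open>Logarithmic differentiation: the first power contributes
  \<open>2 * c * e^2 / (1 - e^2)\<close>. In the second, one factor \<open>1 + e\<close> cancels and
  leaves \<open>- 2 * kappa g * e\<close> over the same denominator.\<close>

lemma prefactor_deriv:
  fixes t :: real and g :: "nat \<Rightarrow> complex" and c :: complex
  assumes "t \<noteq> 0"
  defines "e \<equiv> exp (complex_of_real t)"
  shows "(prefactor g c has_vector_derivative
     (2 * c * e\<^sup>2 - 2 * kappa g * e) / (1 - e\<^sup>2) * prefactor g c t) (at t)"
proof -
  have e: "e = of_real (exp t)" by (simp add: e_def exp_of_real)
  have sq: "exp (2 * t) = (exp t)\<^sup>2" by (simp add: exp_double)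
  have "1 + exp t > 0" by (simp add: add_pos_pos)
  then have ne: "exp t \<noteq> 1" "exp t > 0" "1 + exp t \<noteq> 0" using assms by auto
  then have "(exp t)\<^sup>2 \<noteq> 1" by (auto simp: power2_eq_1_iff)
  with sq have r1: "1 - exp (2 * t) \<noteq> 0" by simp
  have r2: "(1 - exp t) / (1 + exp t) \<noteq> 0" using ne by simp
  have d1: "((\<lambda>t. 1 - exp (2 * t)) has_real_derivative - 2 * (exp t)\<^sup>2) (at t)"
    by (auto intro!: derivative_eq_intros simp: sq)
  have d2: "((\<lambda>t. (1 - exp t) / (1 + exp t)) has_real_derivative - 2 * exp t / (1 + exp t)\<^sup>2) (at t)"
    using ne by (auto intro!: derivative_eq_intros simp: field_simps power2_eq_square)
  have q1: "- 2 * (exp t)\<^sup>2 / (1 - exp (2 * t)) = - 2 * (exp t)\<^sup>2 / (1 - (exp t)\<^sup>2)"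
    by (simp add: sq)
  have "(1 + exp t) * (1 - exp t) = 1 - (exp t)\<^sup>2" by (simp add: power2_eq_square algebra_simps)
  then have q2: "- 2 * exp t / (1 + exp t)\<^sup>2 / ((1 - exp t) / (1 + exp t)) = - 2 * exp t / (1 - (exp t)\<^sup>2)"
    using ne by (simp add: power2_eq_square)
  have c1: "complex_of_real (- 2 * (exp t)\<^sup>2 / (1 - (exp t)\<^sup>2)) = - 2 * e\<^sup>2 / (1 - e\<^sup>2)"
    and c2: "complex_of_real (- 2 * exp t / (1 - (exp t)\<^sup>2)) = - 2 * e / (1 - e\<^sup>2)"
    by (simp_all add: e)
  have alg: "p1 * (k * (- 2 * e / (1 - e\<^sup>2)) * p2) + - c * (- 2 * e\<^sup>2 / (1 - e\<^sup>2)) * p1 * p2 =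
      (2 * c * e\<^sup>2 - 2 * k * e) / (1 - e\<^sup>2) * (p1 * p2)" for p1 p2 k
    by (simp add: algebra_simps diff_divide_distrib)
  show ?thesis
    unfolding prefactor_def
    by (rule has_vector_derivative_eq_rhs[OF has_vector_derivative_mult[OF
          has_vector_derivative_of_real_powr[OF d1 r1] has_vector_derivative_of_real_powr[OF d2 r2]]])
       (simp only: q1 q2 c1 c2 alg)
qed

lemma exp_square_neq_1:
  assumes "t \<noteq> 0"
  shows "(exp (complex_of_real t))\<^sup>2 \<noteq> 1"
proof -
  have "complex_of_real (exp (2 * t)) \<noteq> 1"
    using assms unfolding of_real_eq_1_iff by simp
  then show ?thesis by (simp add: exp_double exp_of_real)
qed

text \<open>The square contains the logarithmic derivative in \<open>z 1\<close>, with prefactor and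
  exponential combined; the terms after it are its derivative, by the quotient rule.\<close>

lemma pderiv2_z1:
  fixes x z :: "nat \<Rightarrow> real" and g :: "nat \<Rightarrow> complex" and a :: complex
  assumes "n \<ge> 1" "z 1 \<noteq> 0"
  defines "e \<equiv> exp (complex_of_real (z 1))" and "B \<equiv> csqrt (g 2 / 2) * exp (of_real (x 1))"
    and "k \<equiv> kappa g" and "c \<equiv> \<i> * a"
  shows "pderiv_at 1 (pderiv_at 1 (\<lambda>z. Q_kernel n g a z x)) z =
    (((c * (1 + e\<^sup>2) - 2 * k * e) / (1 - e\<^sup>2) - B * (e - 1 / e))\<^sup>2
     + (2 * (2 * c * e\<^sup>2 - k * e) * (1 - e\<^sup>2) + 2 * e\<^sup>2 * (2 * c * e\<^sup>2 - 2 * k * e)) / (1 - e\<^sup>2)\<^sup>2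
     - B * (e + 1 / e)) * Q_kernel n g a z x"
proof -
  let ?E = "\<lambda>t. exp (complex_of_real t)"
  define K where "K = exp (exponent n g c z x - c * of_real (z 1) + B * (exp (of_real (z 1)) + exp (- of_real (z 1))))"
  define p where "p t = (2 * c * (?E t)\<^sup>2 - 2 * k * ?E t) / (1 - (?E t)\<^sup>2) + (c - B * (?E t - exp (- of_real t)))" for t
  have Q: "Q_kernel n g a (z(1 := t)) x = K * (prefactor g c t *
      exp (c * of_real t - B * (exp (of_real t) + exp (- of_real t))))" for t
    using assms(1) unfolding Q_kernel_eq K_def mult.left_commute[of "exp _"] exp_add[symmetric]
    by (simp add: exponent_upd_z B_def c_def algebra_simps)
  note ne = exp_square_neq_1
  have "((\<lambda>t. exp (c * of_real t - B * (exp (of_real t) + exp (- of_real t)))) has_vector_derivative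
     (c - B * (?E t - exp (- of_real t))) * exp (c * of_real t - B * (exp (of_real t) + exp (- of_real t)))) (at t)" for t
    by (rule has_vector_derivative_real_field)
       (auto intro!: derivative_eq_intros simp: algebra_simps)
  from has_vector_derivative_mult_right[OF has_vector_derivative_mult[OF prefactor_deriv this]]
  have F: "((\<lambda>s. Q_kernel n g a (z(1 := s)) x) has_vector_derivative
      p t * Q_kernel n g a (z(1 := t)) x) (at t)" if "t \<in> - {0}" for t
    unfolding Q by (rule has_vector_derivative_eq_rhs) (use that in \<open>auto simp: p_def k_def algebra_simps\<close>)
  have "(p has_vector_derivative
      (2 * (2 * c * e\<^sup>2 - k * e) * (1 - e\<^sup>2) + 2 * e\<^sup>2 * (2 * c * e\<^sup>2 - 2 * k * e)) / (1 - e\<^sup>2)\<^sup>2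
     - B * (e + 1 / e)) (at (z 1))"
    unfolding p_def e_def using ne[OF assms(2)]
    by (intro has_vector_derivative_real_field)
       (auto intro!: derivative_eq_intros simp: power2_eq_square exp_minus inverse_eq_divide algebra_simps)
  from pderiv_at_twice[where U = "- {0}", OF _ _ F this]
  have "pderiv_at 1 (pderiv_at 1 (\<lambda>z. Q_kernel n g a z x)) z = ((p (z 1))\<^sup>2 +
      ((2 * (2 * c * e\<^sup>2 - k * e) * (1 - e\<^sup>2) + 2 * e\<^sup>2 * (2 * c * e\<^sup>2 - 2 * k * e)) / (1 - e\<^sup>2)\<^sup>2
     - B * (e + 1 / e))) * Q_kernel n g a z x"
    using assms(2) by auto
  \<comment> \<open>The two parts merge by
    \<open>2 * c * e^2 + c * (1 - e^2) = c * (1 + e^2)\<close>.\<close>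
  moreover have "p (z 1) = (c * (1 + e\<^sup>2) - 2 * k * e) / (1 - e\<^sup>2) - B * (e - 1 / e)"
    using ne[OF assms(2)] unfolding p_def e_def by (simp add: field_simps exp_minus)
  ultimately show ?thesis by (simp only: add_diff_eq)
qed

section \<open>The boundary identity and the comparison of the two sums of squares\<close>

text \<open>With \<open>e = exp z\<^sub>1\<close>, the two singular terms of the potential have the denominators
  \<open>(1 - e)\<^sup>2 / e\<close> and \<open>(1 - e\<^sup>2)\<^sup>2 / e\<^sup>2\<close>.\<close>

lemma inozemtsev_potential_identity:
  fixes e c k B :: complex
  assumes e: "e \<noteq> 0" "e\<^sup>2 \<noteq> 1"
  shows "((c * (1 + e\<^sup>2) - 2 * k * e) / (1 - e\<^sup>2) - B * (e - 1 / e))\<^sup>2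
     + (2 * (2 * c * e\<^sup>2 - k * e) * (1 - e\<^sup>2) + 2 * e\<^sup>2 * (2 * c * e\<^sup>2 - 2 * k * e)) / (1 - e\<^sup>2)\<^sup>2
     - 2 * (- (2 * c + 1) * k * e / (1 - e)\<^sup>2 + (2 * (c + k) + 2 * (c + k)\<^sup>2) * e\<^sup>2 / (1 - e\<^sup>2)\<^sup>2)
     + 4 * k * B + 4 * B\<^sup>2 = (c + B * (e + 1 / e))\<^sup>2"
proof -
  \<comment> \<open>Each fraction is named and multiplied out by a power of \<open>D\<close>,
    leaving polynomial identities.\<close>
  define D where "D = 1 - e\<^sup>2"
  have D: "D \<noteq> 0" using e by (simp add: D_def)
  define P where "P = (c * (1 + e\<^sup>2) - 2 * k * e) / D"
  have PD: "P * D = c * (1 + e\<^sup>2) - 2 * k * e" using D by (simp add: P_def)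
  define R where "R = (2 * (2 * c * e\<^sup>2 - k * e) * D + 2 * e\<^sup>2 * (2 * c * e\<^sup>2 - 2 * k * e)) / D\<^sup>2"
  have R: "R * D\<^sup>2 = 2 * (2 * c * e\<^sup>2 - k * e) * D + 2 * e\<^sup>2 * (2 * c * e\<^sup>2 - 2 * k * e)"
    using D by (simp add: R_def)
  define V where "V = - (2 * c + 1) * k * e / (1 - e)\<^sup>2 + (2 * (c + k) + 2 * (c + k)\<^sup>2) * e\<^sup>2 / D\<^sup>2"
  have "D = (1 - e) * (1 + e)" by (simp add: D_def power2_eq_square algebra_simps)
  then have "e / (1 - e)\<^sup>2 * D\<^sup>2 = e * (1 + e)\<^sup>2" using D by (simp add: power_mult_distrib)
  moreover have "V * D\<^sup>2 = - (2 * c + 1) * k * (e / (1 - e)\<^sup>2 * D\<^sup>2) + (2 * (c + k) + 2 * (c + k)\<^sup>2) * e\<^sup>2"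
    using D unfolding V_def distrib_right by (simp add: mult_ac)
  ultimately have V: "V * D\<^sup>2 = - (2 * c + 1) * k * (e * (1 + e)\<^sup>2) + (2 * (c + k) + 2 * (c + k)\<^sup>2) * e\<^sup>2"
    by simp
  \<comment> \<open>The case \<open>B = 0\<close>: the prefactor times \<open>exp (c * t)\<close> is
    an eigenfunction of the one-variable operator with potential \<open>V\<close>, with eigenvalue
    \<open>- c^2 / 2\<close>.\<close>
  have "(P\<^sup>2 + R - 2 * V) * D\<^sup>2 = (P * D)\<^sup>2 + R * D\<^sup>2 - 2 * (V * D\<^sup>2)"
    by algebra
  also have "\<dots> = c\<^sup>2 * D\<^sup>2"
    unfolding PD R V unfolding D_def by algebra
  finally have 1: "P\<^sup>2 + R - 2 * V = c\<^sup>2" using D by simp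
  define E where "E = 1 / e"
  have E: "e * E = 1" using e by (simp add: E_def)
  \<comment> \<open>The zero of \<open>e - E\<close> cancels the pole of \<open>P\<close>, so the
    term linear in \<open>B\<close> is regular.\<close>
  have "e - E = - D * E" using E by (simp add: D_def algebra_simps power2_eq_square)
  then have "P * (e - E) = - (P * D) * E" by simp
  also have "\<dots> = 2 * k - c * (e + E)" unfolding PD using E by algebra
  finally have 2: "P * (e - E) = 2 * k - c * (e + E)" .
  \<comment> \<open>The \<open>4 * k * B\<close> terms cancel, and
    \<open>(e - E)^2 + 4 = (e + E)^2\<close> because \<open>e * E = 1\<close>.\<close>
  have "(P - B * (e - E))\<^sup>2 + R - 2 * V + 4 * k * B + 4 * B\<^sup>2 = (c + B * (e + E))\<^sup>2"
    using 1 2 E by algebra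
  then show ?thesis unfolding P_def R_def V_def E_def D_def .
qed

text \<open>Here \<open>w 1\<close> is the boundary term
  \<open>csqrt (g\<^sub>2 / 2) (exp (x\<^sub>1 + z\<^sub>1) + exp (x\<^sub>1 - z\<^sub>1))\<close> instead of \<open>exp (x\<^sub>1 - z\<^sub>1)\<close>.\<close>

lemma sum_toda_squares:
  fixes u w :: "nat \<Rightarrow> complex" and c :: complex
  assumes n: "n \<ge> 1"
  defines "v \<equiv> \<lambda>j. if j < n then u (j + 1) else 0"
  shows "(\<Sum>j=1..n. (c + w j - v j)\<^sup>2 - w j - v j) =
    (\<Sum>j=2..n. (c - u j + w j)\<^sup>2 - u j - w j) + (c + w 1)\<^sup>2 - w 1 - 2 * (w 1 * v 1)
    - 2 * (\<Sum>j\<in>{2..<n}. w j * u (j + 1)) + 2 * (\<Sum>j=2..n. u j * w j)"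
proof -
  \<comment> \<open>Expanding the squares, \<open>f\<close> collects the terms in \<open>w\<close>
    alone and \<open>h\<close> those in \<open>u\<close> or \<open>v\<close> alone, so only mixed
    products differ.\<close>
  define h where "h y = y\<^sup>2 - 2 * c * y - y" for y
  define f where "f j = (c + w j)\<^sup>2 - w j" for j
  have "{1..n} = insert 1 {2..n}" using n by auto
  then have split: "sum F {1..n} = F 1 + sum F {2..n}" for F :: "nat \<Rightarrow> complex" by simp
  \<comment> \<open>Index \<open>n\<close> drops out because \<open>v n = 0\<close> and
    \<open>h 0 = 0\<close>.\<close>
  have "(\<Sum>j=1..n. h (v j)) = (\<Sum>j\<in>{1..<n}. h (u (j + 1)))"
    by (rule sum.mono_neutral_cong_right) (auto simp: v_def h_def)
  also have "\<dots> = (\<Sum>j=2..n. h (u j))"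
    by (rule sum.reindex_bij_witness[of _ "\<lambda>i. i - 1" Suc]) auto
  finally have h: "(\<Sum>j=1..n. h (v j)) = (\<Sum>j=2..n. h (u j))" .
  have wv: "(\<Sum>j=2..n. w j * v j) = (\<Sum>j\<in>{2..<n}. w j * u (j + 1))"
    by (rule sum.mono_neutral_cong_right) (auto simp: v_def)
  have "(\<Sum>j=1..n. (c + w j - v j)\<^sup>2 - w j - v j) = (\<Sum>j=1..n. f j + h (v j) - 2 * (w j * v j))"
    by (rule sum.cong) (simp_all add: f_def h_def power2_eq_square algebra_simps)
  also have "\<dots> = f 1 + (\<Sum>j=2..n. f j) + (\<Sum>j=2..n. h (u j))
      - 2 * (w 1 * v 1) - 2 * (\<Sum>j\<in>{2..<n}. w j * u (j + 1))"
    unfolding sum_subtractf sum.distrib h sum_distrib_left[symmetric] wv[symmetric]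
      split[of f] split[of "\<lambda>j. w j * v j"]
    by (simp add: algebra_simps)
  finally have 1: "(\<Sum>j=1..n. (c + w j - v j)\<^sup>2 - w j - v j) = \<dots>" .
  have "(\<Sum>j=2..n. f j) + (\<Sum>j=2..n. h (u j)) =
      (\<Sum>j=2..n. ((c - u j + w j)\<^sup>2 - u j - w j) + 2 * (u j * w j))"
    unfolding sum.distrib[symmetric]
    by (rule sum.cong) (simp_all add: f_def h_def power2_eq_square algebra_simps)
  then have "(\<Sum>j=2..n. f j) + (\<Sum>j=2..n. h (u j)) =
      (\<Sum>j=2..n. (c - u j + w j)\<^sup>2 - u j - w j) + 2 * (\<Sum>j=2..n. u j * w j)"
    by (simp only: sum.distrib sum_distrib_left)
  with 1 show ?thesis
    unfolding f_def[of 1] by algebra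
qed

section \<open>The intertwining relation\<close>

theorem proposition1p4:
  fixes n :: nat and g :: "nat \<Rightarrow> complex" and a :: complex and x z :: "nat \<Rightarrow> real"
  assumes "n \<ge> 1" and "g 2 \<noteq> 0" and "z 1 \<noteq> 0"
  shows "H_I n g a (\<lambda>z. Q_kernel n g a z x) z = H_BC n g (\<lambda>x. Q_kernel n g a z x) x"
proof -
  define c where "c = \<i> * a"
  define A where "A = csqrt (g 2 / 2)"
  define k where "k = kappa g"
  define e where "e = exp (complex_of_real (z 1))"
  define X where "X = exp (complex_of_real (x 1))"
  define u where "u j = g (j + 1) * exp (complex_of_real (z j - x (j - 1)))" for j
  define w where "w j = (if j = 1 then A * of_real (exp (x 1 + z 1) + exp (x 1 - z 1))
      else exp (complex_of_real (x j - z j)))" for j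
  define v where "v j = (if j < n then u (j + 1) else 0)" for j
  define T where "T = ((c * (1 + e\<^sup>2) - 2 * k * e) / (1 - e\<^sup>2) - A * X * (e - 1 / e))\<^sup>2
     + (2 * (2 * c * e\<^sup>2 - k * e) * (1 - e\<^sup>2) + 2 * e\<^sup>2 * (2 * c * e\<^sup>2 - 2 * k * e)) / (1 - e\<^sup>2)\<^sup>2
     - A * X * (e + 1 / e)"
  define V where "V = g1_tilde g a / of_real ((exp (- z 1 / 2) - exp (z 1 / 2))\<^sup>2)
        + g2_tilde g a / of_real ((exp (- z 1) - exp (z 1))\<^sup>2)"
  let ?Q = "Q_kernel n g a z x"
  have A2: "A\<^sup>2 = g 2 / 2" by (simp add: A_def)
  have kA: "2 * k * A = g 1" using csqrt_kappa[of g] assms(2) by (simp add: k_def A_def)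
  have e: "e = of_real (exp (z 1))" by (simp add: e_def exp_of_real)
  have e2: "e\<^sup>2 \<noteq> 1" "e \<noteq> 0" using exp_square_neq_1[OF assms(3)] by (simp_all add: e_def)
  have w1: "w 1 = A * X * (e + 1 / e)"
    by (simp add: w_def X_def e_def exp_add exp_diff algebra_simps flip: exp_of_real)

  have "1 / (exp (- z 1 / 2) - exp (z 1 / 2))\<^sup>2 = exp (z 1) / (1 - exp (z 1))\<^sup>2"
  proof -
    define y where "y = exp (z 1 / 2)"
    have y: "exp (z 1) = y\<^sup>2" "exp (- z 1 / 2) = 1 / y" "y > 0"
      by (simp_all add: y_def exp_minus inverse_eq_divide flip: exp_double)
    have "1 / y - y = (1 - y\<^sup>2) / y" using y(3) by (simp add: field_simps power2_eq_square)
    then show ?thesis unfolding y(1,2) y_def[symmetric] by (simp add: power_divide)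
  qed
  then have V1: "complex_of_real (1 / (exp (- z 1 / 2) - exp (z 1 / 2))\<^sup>2) = e / (1 - e)\<^sup>2"
    by (simp only: e of_real_1 of_real_diff of_real_divide of_real_power)
  have "1 / (exp (- z 1) - exp (z 1))\<^sup>2 = (exp (z 1))\<^sup>2 / (1 - (exp (z 1))\<^sup>2)\<^sup>2"
  proof -
    have "exp (- z 1) - exp (z 1) = (1 - (exp (z 1))\<^sup>2) / exp (z 1)"
      by (simp add: exp_minus field_simps power2_eq_square)
    then show ?thesis by (simp add: power_divide)
  qed
  then have V2: "complex_of_real (1 / (exp (- z 1) - exp (z 1))\<^sup>2) = e\<^sup>2 / (1 - e\<^sup>2)\<^sup>2"
    by (simp only: e of_real_1 of_real_diff of_real_divide of_real_power)
  have div: "w / complex_of_real r = w * of_real (1 / r)" for w r by simp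
  have V: "V = - (2 * c + 1) * k * e / (1 - e)\<^sup>2 + (2 * (c + k) + 2 * (c + k)\<^sup>2) * e\<^sup>2 / (1 - e\<^sup>2)\<^sup>2"
    unfolding V_def div V1 V2
    by (simp add: g1_tilde_def g2_tilde_def c_def k_def)
  \<comment> \<open>With \<open>B = A * X\<close>, the terms \<open>4 * k * B\<close> and
    \<open>4 * B^2\<close> are twice \<open>g 1 * X\<close> and \<open>g 2 * X^2\<close>; the factor
    2 comes from clearing \<open>- 1/2\<close> before the Laplacian.\<close>
  have T: "T - 2 * V + 2 * (g 1 * X + g 2 * X\<^sup>2) = (c + w 1)\<^sup>2 - w 1"
    using inozemtsev_potential_identity[OF e2(2,1), of c k "A * X"] kA A2
    unfolding T_def V w1 by algebra

  have Lz: "laplacian n (\<lambda>z. Q_kernel n g a z x) z = (T + (\<Sum>j=2..n. (c - u j + w j)\<^sup>2 - u j - w j)) * ?Q"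
  proof -
    have *: "pderiv_at 1 (pderiv_at 1 (\<lambda>z. Q_kernel n g a z x)) z = T * ?Q"
      unfolding T_def c_def A_def k_def e_def X_def
      by (rule pderiv2_z1[of n z g a x]) (use assms in auto)
    have "{1..n} = insert 1 {2..n}" using assms(1) by auto
    then have "laplacian n (\<lambda>z. Q_kernel n g a z x) z = T * ?Q +
        (\<Sum>j=2..n. pderiv_at j (pderiv_at j (\<lambda>z. Q_kernel n g a z x)) z)"
      unfolding laplacian_def *[symmetric] by simp
    also have "(\<Sum>j=2..n. pderiv_at j (pderiv_at j (\<lambda>z. Q_kernel n g a z x)) z) =
        (\<Sum>j=2..n. ((c - u j + w j)\<^sup>2 - u j - w j) * ?Q)"
      by (rule sum.cong) (auto simp: pderiv2_z u_def w_def c_def)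
    finally show ?thesis by (simp add: sum_distrib_right distrib_right)
  qed
  have Lx: "laplacian n (\<lambda>x. Q_kernel n g a z x) x = (\<Sum>j=1..n. (c + w j - v j)\<^sup>2 - w j - v j) * ?Q"
    unfolding laplacian_def sum_distrib_right
    by (rule sum.cong[OF refl], subst pderiv2_x)
       (auto simp: u_def v_def w_def c_def A_def)

  \<comment> \<open>\<open>x 1\<close> cancels in the product, giving the coupling of
    \<open>z 1\<close> and \<open>z 2\<close>; for \<open>n = 1\<close> both sides vanish.\<close>
  have wv1: "w 1 * v 1 = (if n \<ge> 2
           then g 3 * A * of_real (exp (z 1 + z 2) + exp (z 2 - z 1)) else 0)"
  proof -
    have "exp (complex_of_real (z 2 - x 1)) * of_real (exp (x 1 + z 1) + exp (x 1 - z 1)) =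
        of_real (exp (z 2 - x 1) * (exp (x 1 + z 1) + exp (x 1 - z 1)))"
      by (simp only: exp_of_real of_real_mult)
    also have "exp (z 2 - x 1) * (exp (x 1 + z 1) + exp (x 1 - z 1)) = exp (z 1 + z 2) + exp (z 2 - z 1)"
      by (simp add: distrib_left add.commute flip: exp_add)
    finally show ?thesis
      by (auto simp: w_def v_def u_def numeral_eq_Suc mult_ac)
  qed
  have wu: "(\<Sum>j\<in>{2..<n}. w j * u (j + 1)) =
      (\<Sum>j\<in>{2..<n}. g (j + 2) * exp (of_real (z (j + 1) - z j)))"
    by (rule sum.cong) (auto simp: w_def u_def exp_diff)
  \<comment> \<open>\<open>z j\<close> cancels, and the shift from \<open>j\<close> to
    \<open>j - 1\<close> matches the numbering of the BC couplings.\<close>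
  have uw: "(\<Sum>j=2..n. u j * w j) = (\<Sum>j\<in>{1..<n}. g (j + 2) * exp (of_real (x (j + 1) - x j)))"
    by (rule sum.reindex_bij_witness[of _ Suc "\<lambda>i. i - 1"])
       (auto simp: u_def w_def exp_diff numeral_eq_Suc)
  have X2: "exp (complex_of_real (2 * x 1)) = X\<^sup>2"
    by (simp add: X_def exp_double)

  \<comment> \<open>Both sides are now multiples of \<open>?Q\<close>: the mixed sums supply the
    Toda potentials and \<open>T\<close> settles the boundary terms.\<close>
  show ?thesis
    unfolding H_I_def H_BC_def Lz Lx V_def[symmetric] A_def[symmetric] X_def[symmetric] X2
      wv1[symmetric] wu[symmetric] uw[symmetric]
      sum_toda_squares[OF assms(1), of c w u, folded v_def]
    using T by algebra
qed

end
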